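(* Let $0<\alpha<1$, and let $A>0$, $B>0$ and $M_0\in(0,\infty)$ satisfy $A+B\alpha=\frac{2}{M_0^2}$. Consider the piston problem for the modified Chaplygin gas in coordinates moving with the piston, with piston velocity $v_0=-\sqrt2$ (the piston rushes into the gas): in $\Omega=\{(t,x): x<0,\ t>0\}$, $$\rho_t+(\rho u)_x=0,\qquad (\rho u)_t+(\rho u^2+P(\rho))_x=0,\qquad P(\rho)=A\rho-\frac{B}{\rho^{\alpha}},$$ with initial condition $(\rho,u)|_{t=0}=(1,\sqrt2)$ for $x<0$ and boundary condition $\rho u=0$ on $x=0$. Then there exists a unique shock wave solution of this problem connecting the states $V_0=(1,\sqrt2)$ and $V_1=(\rho_1,0)$ in $\Omega$. That is, there is exactly one pair $(\rho_1,\sigma)$ with $\rho_1>0$ and $\sigma<0$ such that $$(\rho,u)(t,x)=\begin{cases}(1,\sqrt2), & x/t<\sigma,\\ (\rho_1,0), & \sigma<x/t\le 0,\end{cases}$$ is an integral solution of the problem.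
   Context: Here $\rho>0$ is the density, $u$ the velocity relative to the piston, and $P$ the pressure. The variables are non-dimensionalized so that the initial density is $\rho_0=1$ and the piston velocity is $v_0=\pm\sqrt2$. The initial velocity in the moving frame is $u_0=-v_0$. The number $M_0=|v_0|/c_0$, with $c_0=\sqrt{P'(\rho_0)}=\sqrt{A+B\alpha}$, is the Mach number of the piston, which gives the relation $A+B\alpha=2/M_0^2$. Integral solution: a pair $(\rho,u)\in L^\infty([0,\infty)\times(-\infty,0])$ is an integral solution of the piston problem with initial data $(\rho_0,u_0)$ if for every $\phi\in C_0^1(\mathbb R^2)$ ($C^1$ with compact support) $$\int_\Omega(\rho\,\partial_t\phi+\rho u\,\partial_x\phi)\,dx\,dt+\int_{-\infty}^0\rho_0(x)\phi(0,x)\,dx=0,$$ $$\int_\Omega\big(\rho u\,\partial_t\phi+(\rho u^2+P)\,\partial_x\phi\big)\,dx\,dt-\int_0^\infty P(t,0)\phi(t,0)\,dt+\int_{-\infty}^0\rho_0(x)u_0(x)\phi(0,x)\,dx=0,$$ where $P(t,x)=P(\rho(t,x))$ and $P(t,0)$ is its boundary value at $x=0$ (for the piecewise constant functions considered here, $P(t,0)=P(\rho_1)$). *)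

theory Defs
  imports "HOL-Analysis.Analysis"
begin

text \<open>Functions of time and space take the pair \<open>(t, x)\<close> as argument.\<close>

definition chaplygin_pressure :: "real \<Rightarrow> real \<Rightarrow> real \<Rightarrow> real \<Rightarrow> real" where
  "chaplygin_pressure A B \<alpha> \<rho> = A * \<rho> - B / \<rho> powr \<alpha>"

definition C1_compact_support :: "(real \<times> real \<Rightarrow> real) \<Rightarrow> bool" where
  "C1_compact_support \<phi> \<longleftrightarrow>
     (\<exists>\<phi>' :: real \<times> real \<Rightarrow> (real \<times> real) \<Rightarrow>\<^sub>L real.
        (\<forall>z. (\<phi> has_derivative blinfun_apply (\<phi>' z)) (at z)) \<and> continuous_on UNIV \<phi>') \<and>
     compact (closure {z. \<phi> z \<noteq> 0})"

definition partial_t :: "(real \<times> real \<Rightarrow> real) \<Rightarrow> real \<times> real \<Rightarrow> real" where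
  "partial_t \<phi> z = deriv (\<lambda>s. \<phi> (s, snd z)) (fst z)"

definition partial_x :: "(real \<times> real \<Rightarrow> real) \<Rightarrow> real \<times> real \<Rightarrow> real" where
  "partial_x \<phi> z = deriv (\<lambda>y. \<phi> (fst z, y)) (snd z)"

definition Linf_on :: "'a::euclidean_space set \<Rightarrow> ('a \<Rightarrow> real) \<Rightarrow> bool" where
  "Linf_on S f \<longleftrightarrow>
     set_borel_measurable lebesgue S f \<and> (\<exists>C. AE z in lebesgue. z \<in> S \<longrightarrow> \<bar>f z\<bar> \<le> C)"

definition piston_domain :: "(real \<times> real) set" where
  "piston_domain = {(t, x). t > 0 \<and> x < 0}"

text \<open>The function \<open>p\<close> is the boundary value of the pressure at the piston, taken as the
  one-sided limit of \<open>P (\<rho> (t, x))\<close> as \<open>x\<close> tends to 0 from the left. The boundary condition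
  \<open>\<rho> u = 0\<close> on \<open>x = 0\<close> is encoded weakly: test functions need not vanish at \<open>x = 0\<close>, and the
  only boundary term there is the pressure in the momentum balance. The integrability conditions
  ensure that the integrals exist, as the Bochner integral of a non-integrable function is 0.\<close>

definition piston_integral_solution ::
  "(real \<Rightarrow> real) \<Rightarrow> (real \<Rightarrow> real) \<Rightarrow> (real \<Rightarrow> real) \<Rightarrow>
   (real \<times> real \<Rightarrow> real) \<Rightarrow> (real \<times> real \<Rightarrow> real) \<Rightarrow> bool" where
  "piston_integral_solution P \<rho>\<^sub>0 u\<^sub>0 \<rho> u \<longleftrightarrow>
     Linf_on ({0..} \<times> {..0}) \<rho> \<and> Linf_on ({0..} \<times> {..0}) u \<and>
     (\<exists>p. (AE t in lebesgue. t > 0 \<longrightarrow> ((\<lambda>x. P (\<rho> (t, x))) \<longlongrightarrow> p t) (at_left 0)) \<and>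
       (\<forall>\<phi>. C1_compact_support \<phi> \<longrightarrow>
          set_integrable lebesgue piston_domain
            (\<lambda>z. \<rho> z * partial_t \<phi> z + \<rho> z * u z * partial_x \<phi> z) \<and>
          set_integrable lebesgue {..<0} (\<lambda>x. \<rho>\<^sub>0 x * \<phi> (0, x)) \<and>
          set_integrable lebesgue piston_domain
            (\<lambda>z. \<rho> z * u z * partial_t \<phi> z + (\<rho> z * (u z)\<^sup>2 + P (\<rho> z)) * partial_x \<phi> z) \<and>
          set_integrable lebesgue {0<..} (\<lambda>t. p t * \<phi> (t, 0)) \<and>
          set_integrable lebesgue {..<0} (\<lambda>x. \<rho>\<^sub>0 x * u\<^sub>0 x * \<phi> (0, x)) \<and>
          (LINT z:piston_domain|lebesgue.
             \<rho> z * partial_t \<phi> z + \<rho> z * u z * partial_x \<phi> z)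
          + (LINT x:{..<0}|lebesgue. \<rho>\<^sub>0 x * \<phi> (0, x)) = 0 \<and>
          (LINT z:piston_domain|lebesgue.
             \<rho> z * u z * partial_t \<phi> z + (\<rho> z * (u z)\<^sup>2 + P (\<rho> z)) * partial_x \<phi> z)
          - (LINT t:{0<..}|lebesgue. p t * \<phi> (t, 0))
          + (LINT x:{..<0}|lebesgue. \<rho>\<^sub>0 x * u\<^sub>0 x * \<phi> (0, x)) = 0))"

text \<open>One component of a self-similar two-state wave with left state \<open>a\<close>, right state \<open>b\<close> and
  speed \<open>\<sigma>\<close>. The value on the null sets \<open>x = \<sigma> t\<close> and \<open>t = 0\<close> is immaterial.\<close>

definition shock_wave :: "real \<Rightarrow> real \<Rightarrow> real \<Rightarrow> real \<times> real \<Rightarrow> real" where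
  "shock_wave \<sigma> a b = (\<lambda>(t, x). if x / t < \<sigma> then a else b)"

end

theory Submission
  imports Defs
begin

text \<open>Integrating by parts on the two sides of the line \<open>x = \<sigma> t\<close> turns the weak formulation for a
  two-state wave into a multiple of \<open>\<integral> \<phi> (t, \<sigma> t) dt\<close>, the boundary terms cancelling against the data;
  so being an integral solution is equivalent to the Rankine-Hugoniot conditions. Here these are
  \<open>\<sigma> (1 - \<rho>\<^sub>1) = \<surd>2\<close> and \<open>P \<rho>\<^sub>1 - P 1 = 2 \<rho>\<^sub>1 / (\<rho>\<^sub>1 - 1)\<close>. Since \<open>\<sigma> < 0\<close> forces \<open>\<rho>\<^sub>1 > 1\<close>, where the left-hand
  side of the second equation increases from 0 to infinity and the right-hand side decreases, there
  is exactly one solution.\<close>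

section \<open>Half-line integrals of derivatives, and regularity of test functions\<close>

lemma integrable_lborel_bounded_support:
  fixes f :: "'a::euclidean_space \<Rightarrow> real"
  assumes "continuous_on UNIV f" and "\<And>z. R < norm z \<Longrightarrow> f z = 0"
  shows "integrable lborel f"
proof -
  have "integrable lborel (\<lambda>z. indicator (cball 0 R) z *\<^sub>R f z)"
    using assms(1) by (intro borel_integrable_compact) (auto intro: continuous_on_subset)
  moreover have "(\<lambda>z. indicator (cball 0 R) z *\<^sub>R f z) = f"
    using assms(2) by (force simp: indicator_def)
  ultimately show ?thesis by simp
qed

text \<open>The fundamental theorem of calculus on a bounded interval whose outer endpoint lies
  beyond the support. Open and closed right half-lines are both provided: the initial time is
  excluded from the domain, whereas the shock line belongs to the state behind it.\<close>

lemma LINT_derivative_bounded_support: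
  fixes f f' :: "real \<Rightarrow> real"
  assumes deriv: "\<And>x. (f has_real_derivative f' x) (at x)" and cont: "continuous_on UNIV f'"
    and f: "\<And>x. R < \<bar>x\<bar> \<Longrightarrow> f x = 0" and f': "\<And>x. R < \<bar>x\<bar> \<Longrightarrow> f' x = 0"
  shows LINT_lessThan_derivative: "(LINT x:{..<c}|lborel. f' x) = f c"
    and LINT_atLeast_derivative: "(LINT x:{c..}|lborel. f' x) = - f c"
    and LINT_greaterThan_derivative: "(LINT x:{c<..}|lborel. f' x) = - f c"
proof -
  \<comment> \<open>Absolute values are taken since \<open>R\<close> may be negative; the
    \<open>+ 1\<close> puts \<open>K\<close> strictly beyond \<open>R\<close>, where
    \<open>f\<close> is known to vanish.\<close>
  define K where "K = \<bar>R\<bar> + \<bar>c\<bar> + 1"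
  have K: "R < \<bar>K\<bar>" "R < \<bar>-K\<bar>" "-K \<le> c" "c \<le> K" by (auto simp: K_def)
  have FTC: "(LINT x|lborel. indicator {a..b} x *\<^sub>R f' x) = f b - f a" if "a \<le> b" for a b
    using that deriv cont
    by (intro integral_FTC_atLeastAtMost)
      (auto simp: has_real_derivative_iff_has_vector_derivative[symmetric]
        intro: has_field_derivative_at_within continuous_on_subset)
  have [measurable]: "f' \<in> borel_measurable lborel"
    using cont by (simp add: borel_measurable_continuous_onI)
  have "(LINT x:{..<c}|lborel. f' x) = (LINT x|lborel. indicator {-K..c} x *\<^sub>R f' x)"
    unfolding set_lebesgue_integral_def
    by (rule integral_cong_AE; (measurable; fail)?)
      (use AE_lborel_singleton[of c] in eventually_elim, auto simp: indicator_def K_def intro!: f')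
  then show "(LINT x:{..<c}|lborel. f' x) = f c"
    using FTC[of "-K" c] K by (simp add: f)
  have "(LINT x:{c..}|lborel. f' x) = (LINT x|lborel. indicator {c..K} x *\<^sub>R f' x)"
    unfolding set_lebesgue_integral_def
    by (intro Bochner_Integration.integral_cong) (auto simp: indicator_def K_def intro!: f')
  then show "(LINT x:{c..}|lborel. f' x) = - f c"
    using FTC[of c K] K by (simp add: f)
  moreover have "(LINT x:{c<..}|lborel. f' x) = (LINT x:{c..}|lborel. f' x)"
    unfolding set_lebesgue_integral_def
    by (rule integral_cong_AE; (measurable; fail)?)
      (use AE_lborel_singleton[of c] in eventually_elim, auto simp: indicator_def)
  ultimately show "(LINT x:{c<..}|lborel. f' x) = - f c" by simp
qed

text \<open>The partial derivatives are the values of the Frechet derivative at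
  \<open>(1, 0)\<close> and \<open>(0, 1)\<close>, hence continuous. One radius \<open>R\<close>
  serves the function and both partials, because the derivative vanishes wherever the function is
  locally zero.\<close>

lemma C1_compact_supportE:
  assumes "C1_compact_support \<phi>"
  obtains R where "continuous_on UNIV \<phi>"
    and "continuous_on UNIV (partial_t \<phi>)" and "continuous_on UNIV (partial_x \<phi>)"
    and "\<And>t x. ((\<lambda>s. \<phi> (s, x)) has_real_derivative partial_t \<phi> (t, x)) (at t)"
    and "\<And>t x. ((\<lambda>y. \<phi> (t, y)) has_real_derivative partial_x \<phi> (t, x)) (at x)"
    and "\<And>z. R < norm z \<Longrightarrow> \<phi> z = 0"
    and "\<And>z. R < norm z \<Longrightarrow> partial_t \<phi> z = 0"
    and "\<And>z. R < norm z \<Longrightarrow> partial_x \<phi> z = 0"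
proof -
  obtain \<phi>' :: "real \<times> real \<Rightarrow> (real \<times> real) \<Rightarrow>\<^sub>L real"
    where \<phi>': "\<And>z. (\<phi> has_derivative blinfun_apply (\<phi>' z)) (at z)"
      and cont: "continuous_on UNIV \<phi>'" and "compact (closure {z. \<phi> z \<noteq> 0})"
    using assms unfolding C1_compact_support_def by blast
  then obtain R where "\<And>z. z \<in> closure {z. \<phi> z \<noteq> 0} \<Longrightarrow> norm z \<le> R"
    using compact_imp_bounded bounded_iff by metis
  then have R: "\<phi> z = 0" if "R < norm z" for z
    using that closure_subset by (smt (verit) mem_Collect_eq subset_iff)
  have \<phi>'_0: "blinfun_apply (\<phi>' z) = (\<lambda>_. 0)" if "R < norm z" for z
  proof -
    \<comment> \<open>The strict inequality makes this set open, so the function is zero near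
      \<open>z\<close> and not only at \<open>z\<close>.\<close>
    have "open {z::real \<times> real. R < norm z}"
      by (intro open_Collect_less continuous_intros)
    then have "(\<phi> has_derivative (\<lambda>_. 0)) (at z)"
      by (rule has_derivative_transform_within_open[OF has_derivative_const]) (use that R in auto)
    with \<phi>' show ?thesis by (rule has_derivative_unique)
  qed
  have fst_scale: "(\<lambda>h. \<phi>' z (h, 0)) = (*) (\<phi>' z (1, 0))" for z
  proof
    show "\<phi>' z (h, 0) = \<phi>' z (1, 0) * h" for h
      using blinfun.scaleR_right[of "\<phi>' z" h "(1, 0)"] by simp
  qed
  have snd_scale: "(\<lambda>h. \<phi>' z (0, h)) = (*) (\<phi>' z (0, 1))" for z
  proof
    show "\<phi>' z (0, h) = \<phi>' z (0, 1) * h" for h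
      using blinfun.scaleR_right[of "\<phi>' z" h "(0, 1)"] by simp
  qed
  have dt: "((\<lambda>s. \<phi> (s, x)) has_real_derivative \<phi>' (t, x) (1, 0)) (at t)" for t x
  proof -
    have "((\<lambda>s. \<phi> (s, x)) has_derivative (\<lambda>h. \<phi>' (t, x) (h, 0))) (at t)"
      by (rule has_derivative_compose[OF has_derivative_Pair[OF has_derivative_ident has_derivative_const] \<phi>'])
    then show ?thesis unfolding has_field_derivative_def fst_scale .
  qed
  have dx: "((\<lambda>y. \<phi> (t, y)) has_real_derivative \<phi>' (t, x) (0, 1)) (at x)" for t x
  proof -
    have "((\<lambda>y. \<phi> (t, y)) has_derivative (\<lambda>h. \<phi>' (t, x) (0, h))) (at x)"
      by (rule has_derivative_compose[OF has_derivative_Pair[OF has_derivative_const has_derivative_ident] \<phi>'])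
    then show ?thesis unfolding has_field_derivative_def snd_scale .
  qed
  have pt: "partial_t \<phi> z = \<phi>' z (1, 0)" for z
    using DERIV_imp_deriv[OF dt] by (cases z) (simp add: partial_t_def)
  have px: "partial_x \<phi> z = \<phi>' z (0, 1)" for z
    using DERIV_imp_deriv[OF dx] by (cases z) (simp add: partial_x_def)
  show ?thesis
  proof (rule that[of R])
    show "continuous_on UNIV \<phi>"
      using \<phi>' by (meson continuous_at_imp_continuous_on has_derivative_continuous)
    show "continuous_on UNIV (partial_t \<phi>)" "continuous_on UNIV (partial_x \<phi>)"
      unfolding pt px by (intro continuous_intros cont)+
  qed (use dt dx R \<phi>'_0 in \<open>simp_all add: pt px\<close>)
qed

section \<open>Measurability and integrability of two-state waves\<close>

lemma borel_measurable_shock_wave [measurable]: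
  "shock_wave \<sigma> a b \<in> borel_measurable borel"
proof -
  have "(\<lambda>z::real \<times> real. if snd z / fst z < \<sigma> then a else b) \<in> borel_measurable (borel \<Otimes>\<^sub>M borel)"
    by measurable
  then show ?thesis
    by (simp add: borel_prod shock_wave_def case_prod_unfold)
qed

lemma abs_shock_wave_le: "\<bar>shock_wave \<sigma> a b z\<bar> \<le> \<bar>a\<bar> + \<bar>b\<bar>"
  by (simp add: shock_wave_def case_prod_unfold)

lemma Linf_on_shock_wave: "S \<in> sets borel \<Longrightarrow> Linf_on S (shock_wave \<sigma> a b)"
  unfolding Linf_on_def set_borel_measurable_def
  using abs_shock_wave_le[of \<sigma> a b]
  by (intro conjI measurable_completion exI[of _ "\<bar>a\<bar> + \<bar>b\<bar>"]) auto

lemma piston_domain_borel [measurable]: "piston_domain \<in> sets borel"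
proof -
  have "piston_domain = {0<..} \<times> {..<0}" by (auto simp: piston_domain_def)
  moreover have "open ({0<..} \<times> {..<0::real} :: (real \<times> real) set)"
    by (intro open_Times) auto
  ultimately show ?thesis by simp
qed

lemma integrable_lborel_shock_wave_mult:
  assumes "integrable lborel f"
  shows "integrable lborel (\<lambda>z. shock_wave \<sigma> a b z * f z)"
proof (rule Bochner_Integration.integrable_bound)
  show "integrable lborel (\<lambda>z. (\<bar>a\<bar> + \<bar>b\<bar>) * f z)" using assms by simp
  show "(\<lambda>z. shock_wave \<sigma> a b z * f z) \<in> borel_measurable lborel"
    using borel_measurable_integrable[OF assms] by simp
  show "AE z in lborel. norm (shock_wave \<sigma> a b z * f z) \<le> norm ((\<bar>a\<bar> + \<bar>b\<bar>) * f z)"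
    by (simp add: abs_mult mult_right_mono abs_shock_wave_le)
qed

lemma integrable_indicator_mult:
  fixes f :: "'a \<Rightarrow> real"
  assumes "A \<in> sets M" and "integrable M f"
  shows "integrable M (\<lambda>z. indicator A z * f z)"
  using integrable_mult_indicator[OF assms] by simp

section \<open>Integration by parts on the two sides of the shock line\<close>

lemma integrable_lborel_slices:
  fixes \<psi> :: "real \<times> real \<Rightarrow> real"
  assumes "continuous_on UNIV \<psi>" and "\<And>z. R < norm z \<Longrightarrow> \<psi> z = 0"
  shows integrable_lborel_slice_snd: "integrable lborel (\<lambda>x. \<psi> (t, x))"
    and integrable_lborel_slice_line: "integrable lborel (\<lambda>t. \<psi> (t, c * t))"
proof -
  have zero: "\<psi> (t, x) = 0" if "R < \<bar>t\<bar> \<or> R < \<bar>x\<bar>" for t x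
    using that assms(2)[of "(t, x)"] norm_fst_le[of t x] norm_snd_le[of x t] by auto
  show "integrable lborel (\<lambda>x. \<psi> (t, x))"
    by (rule integrable_lborel_bounded_support[where R = R])
      (auto intro!: continuous_on_compose2[OF assms(1)] continuous_intros zero)
  show "integrable lborel (\<lambda>t. \<psi> (t, c * t))"
    by (rule integrable_lborel_bounded_support[where R = R])
      (auto intro!: continuous_on_compose2[OF assms(1)] continuous_intros zero)
qed

text \<open>Fubini with \<open>x\<close> as the inner variable: at a fixed time \<open>t > 0\<close>
  the wave is a combination of two left half-lines, ending at the shock and at the piston, and each
  contributes the trace of the test function at its endpoint.\<close>

lemma LINT_shock_wave_partial_x:
  assumes "C1_compact_support \<phi>" and "\<sigma> < 0"
  shows "(LINT z:piston_domain|lborel. shock_wave \<sigma> a b z * partial_x \<phi> z) =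
    (a - b) * (LINT t:{0<..}|lborel. \<phi> (t, \<sigma> * t)) + b * (LINT t:{0<..}|lborel. \<phi> (t, 0))"
proof -
  obtain R where \<phi>: "continuous_on UNIV \<phi>" "continuous_on UNIV (partial_x \<phi>)"
    "\<And>t x. ((\<lambda>y. \<phi> (t, y)) has_real_derivative partial_x \<phi> (t, x)) (at x)"
    "\<And>z. R < norm z \<Longrightarrow> \<phi> z = 0" "\<And>z. R < norm z \<Longrightarrow> partial_x \<phi> z = 0"
    using assms(1) by (rule C1_compact_supportE) blast
  define h where "h z = indicator piston_domain z * (shock_wave \<sigma> a b z * partial_x \<phi> z)" for z
  have "integrable lborel h"
    unfolding h_def
    by (intro integrable_indicator_mult integrable_lborel_shock_wave_mult
        integrable_lborel_bounded_support \<phi>) auto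
  then have "(LINT z|lborel. h z) = (LINT t|lborel. LINT x|lborel. h (t, x))"
    by (subst lborel_pair.integral_fst') (simp_all add: lborel_prod)
  also have "\<dots> = (LINT t|lborel. (a - b) * (indicator {0<..} t * \<phi> (t, \<sigma> * t))
      + b * (indicator {0<..} t * \<phi> (t, 0)))"
  proof (rule Bochner_Integration.integral_cong[OF refl])
    fix t :: real
    show "(LINT x|lborel. h (t, x)) = (a - b) * (indicator {0<..} t * \<phi> (t, \<sigma> * t))
      + b * (indicator {0<..} t * \<phi> (t, 0))"
    proof (cases "t > 0")
      case False
      then show ?thesis by (simp add: h_def piston_domain_def)
    next
      case True
      have half_line: "(LINT x|lborel. indicator {..<c} x * partial_x \<phi> (t, x)) = \<phi> (t, c)" for c
      proof -
        have "R < \<bar>x\<bar> \<Longrightarrow> R < norm (t, x)" for x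
          using norm_snd_le[of x t] by simp
        then have "(LINT x:{..<c}|lborel. partial_x \<phi> (t, x)) = \<phi> (t, c)"
          by (intro LINT_lessThan_derivative[where R = R] \<phi>
              continuous_on_compose2[OF \<phi>(2)] continuous_intros) auto
        then show ?thesis by (simp add: set_lebesgue_integral_def)
      qed
      \<comment> \<open>Since \<open>\<sigma> * t < 0\<close>, the half-line ahead of the shock lies
        inside the gas region; the coefficients add up to \<open>a\<close> there and leave
        \<open>b\<close> behind the shock.\<close>
      have "h (t, x) = (a - b) * (indicator {..<\<sigma> * t} x * partial_x \<phi> (t, x))
          + b * (indicator {..<0} x * partial_x \<phi> (t, x))" for x
        using True mult_neg_pos[OF assms(2) True]
        by (auto simp: h_def piston_domain_def shock_wave_def indicator_def pos_divide_less_eq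
            algebra_simps)
      moreover have "integrable lborel (\<lambda>x. indicator {..<c} x * partial_x \<phi> (t, x))" for c
        by (intro integrable_indicator_mult integrable_lborel_slice_snd \<phi>) auto
      ultimately show ?thesis
        using True by (simp add: half_line)
    qed
  qed
  also have "\<dots> = (a - b) * (LINT t|lborel. indicator {0<..} t * \<phi> (t, \<sigma> * t))
      + b * (LINT t|lborel. indicator {0<..} t * \<phi> (t, 0))"
  proof -
    \<comment> \<open>\<open>c = \<sigma>\<close> is the shock line and \<open>c = 0\<close> the
      piston.\<close>
    have "integrable lborel (\<lambda>t. indicator {0<..} t * \<phi> (t, c * t))" for c
      by (intro integrable_indicator_mult integrable_lborel_slice_line \<phi>) auto
    from this[of \<sigma>] this[of 0] show ?thesis by simp
  qed
  finally show ?thesis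
    by (simp add: set_lebesgue_integral_def h_def)
qed

text \<open>Fubini with \<open>t\<close> as the inner variable: a fixed \<open>x < 0\<close> is in
  state \<open>a\<close> from time 0 and jumps to \<open>b\<close> when the shock arrives at time
  \<open>x / \<sigma>\<close>. The substitution \<open>x = \<sigma> * t\<close> then turns the
  integral over the shock into one over time, with Jacobian \<open>- \<sigma>\<close>.\<close>

lemma LINT_shock_wave_partial_t:
  assumes "C1_compact_support \<phi>" and "\<sigma> < 0"
  shows "(LINT z:piston_domain|lborel. shock_wave \<sigma> a b z * partial_t \<phi> z) =
    - \<sigma> * (a - b) * (LINT t:{0<..}|lborel. \<phi> (t, \<sigma> * t)) - a * (LINT x:{..<0}|lborel. \<phi> (0, x))"
proof -
  obtain R where \<phi>: "continuous_on UNIV \<phi>" "continuous_on UNIV (partial_t \<phi>)"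
    "\<And>t x. ((\<lambda>s. \<phi> (s, x)) has_real_derivative partial_t \<phi> (t, x)) (at t)"
    "\<And>z. R < norm z \<Longrightarrow> \<phi> z = 0" "\<And>z. R < norm z \<Longrightarrow> partial_t \<phi> z = 0"
    using assms(1) by (rule C1_compact_supportE) blast
  define h where "h z = indicator piston_domain z * (shock_wave \<sigma> a b z * partial_t \<phi> z)" for z
  have line: "integrable lborel (\<lambda>t. indicator {0<..} t * \<phi> (t, \<sigma> * t))"
    by (intro integrable_indicator_mult integrable_lborel_slice_line \<phi>) auto
  \<comment> \<open>The integrand after the affine substitution, in the shape in which the
    substitution rule produces it; as \<open>\<sigma> < 0\<close>, positive times become negative
    positions.\<close>
  have change: "indicator {0<..} (1 / \<sigma> * x) * \<phi> (1 / \<sigma> * x, \<sigma> * (1 / \<sigma> * x))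
      = indicator {..<0} x * \<phi> (x / \<sigma>, x)" for x
    using assms(2) by (simp add: indicator_def zero_less_divide_iff)
  have line': "integrable lborel (\<lambda>x. indicator {..<0} x * \<phi> (x / \<sigma>, x))"
    using lborel_integrable_real_affine[OF line, of "1 / \<sigma>" 0] assms(2) by (simp only: change add_0) auto
  have LINT_line: "(LINT x|lborel. indicator {..<0} x * \<phi> (x / \<sigma>, x)) =
      - \<sigma> * (LINT t|lborel. indicator {0<..} t * \<phi> (t, \<sigma> * t))"
    using lborel_integral_real_affine[of "1 / \<sigma>" "\<lambda>t. indicator {0<..} t * \<phi> (t, \<sigma> * t)" 0] assms(2)
    by (simp only: change add_0) (simp add: field_simps)
  have "integrable lborel h"
    unfolding h_def
    by (intro integrable_indicator_mult integrable_lborel_shock_wave_mult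
        integrable_lborel_bounded_support \<phi>) auto
  then have "(LINT z|lborel. h z) = (LINT x|lborel. LINT t|lborel. h (t, x))"
    by (subst lborel_pair.integral_snd) (simp_all add: lborel_prod)
  also have "\<dots> = (LINT x|lborel. (a - b) * (indicator {..<0} x * \<phi> (x / \<sigma>, x))
      - a * (indicator {..<0} x * \<phi> (0, x)))"
  proof (rule Bochner_Integration.integral_cong[OF refl])
    fix x :: real
    show "(LINT t|lborel. h (t, x)) = (a - b) * (indicator {..<0} x * \<phi> (x / \<sigma>, x))
      - a * (indicator {..<0} x * \<phi> (0, x))"
    proof (cases "x < 0")
      case False
      then show ?thesis by (simp add: h_def piston_domain_def)
    next
      case True
      have bound: "R < \<bar>t\<bar> \<Longrightarrow> R < norm (t, x)" for t
        using norm_fst_le[of t x] by simp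
      have cont: "continuous_on UNIV (\<lambda>t. partial_t \<phi> (t, x))"
        by (intro continuous_on_compose2[OF \<phi>(2)] continuous_intros) auto
      have half_lines: "(LINT t|lborel. indicator {c<..} t * partial_t \<phi> (t, x)) = - \<phi> (c, x)"
        "(LINT t|lborel. indicator {c..} t * partial_t \<phi> (t, x)) = - \<phi> (c, x)" for c
        using LINT_greaterThan_derivative[OF \<phi>(3) cont, where R = R and c = c]
          LINT_atLeast_derivative[OF \<phi>(3) cont, where R = R and c = c] \<phi>(4,5) bound
        by (simp_all add: set_lebesgue_integral_def)
      \<comment> \<open>The times after the arrival of the shock are all positive, so the jump term
        needs no further cut-off at time 0.\<close>
      have t_pos: "0 < t" if "\<sigma> * t \<le> x" for t
        using that True mult_nonpos_nonpos[of \<sigma> t] assms(2) by linarith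
      \<comment> \<open>The half-line of the jump term is closed because on the line
        \<open>x = \<sigma> * t\<close> the wave takes the value \<open>b\<close>.\<close>
      have "h (t, x) = a * (indicator {0<..} t * partial_t \<phi> (t, x))
          + (b - a) * (indicator {x / \<sigma>..} t * partial_t \<phi> (t, x))" for t
        using True assms(2) t_pos[of t]
        by (auto simp: h_def piston_domain_def shock_wave_def indicator_def pos_divide_less_eq
            neg_divide_le_eq algebra_simps)
      moreover have "integrable lborel (\<lambda>t. indicator A t * partial_t \<phi> (t, x))"
        if "A \<in> sets borel" for A
        using that by (intro integrable_indicator_mult integrable_lborel_bounded_support[OF cont])
          (auto intro: \<phi> bound)
      ultimately show ?thesis
        using True by (simp add: half_lines) (simp add: algebra_simps)
    qed
  qed
  also have "\<dots> = (a - b) * (LINT x|lborel. indicator {..<0} x * \<phi> (x / \<sigma>, x))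
      - a * (LINT x|lborel. indicator {..<0} x * \<phi> (0, x))"
  proof -
    have "integrable lborel (\<lambda>x. indicator {..<0} x * \<phi> (0, x))"
      by (intro integrable_indicator_mult integrable_lborel_slice_snd \<phi>) auto
    then show ?thesis using line' by simp
  qed
  finally show ?thesis
    by (simp add: set_lebesgue_integral_def h_def LINT_line algebra_simps)
qed

text \<open>Solutions are defined through the completed measure, while Fubini and substitution are
  carried out on \<open>lborel\<close>; for Borel integrands the two agree.\<close>

lemma set_integrable_lebesgue_iff_lborel:
  fixes f :: "'a::euclidean_space \<Rightarrow> real"
  assumes [measurable]: "A \<in> sets borel" "f \<in> borel_measurable borel"
  shows "set_integrable lebesgue A f \<longleftrightarrow> set_integrable lborel A f"
  unfolding set_integrable_def by (intro integrable_completion) measurable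

lemma LINT_lebesgue_eq_lborel:
  fixes f :: "'a::euclidean_space \<Rightarrow> real"
  assumes [measurable]: "A \<in> sets borel" "f \<in> borel_measurable borel"
  shows "(LINT x:A|lebesgue. f x) = (LINT x:A|lborel. f x)"
  unfolding set_lebesgue_integral_def by (intro integral_completion) measurable

text \<open>Here \<open>a\<close>, \<open>b\<close> are the two values of a conserved quantity and
  \<open>f\<close>, \<open>g\<close> those of its flux, so that one computation serves both mass and
  momentum. The coefficient of the shock integral is the Rankine-Hugoniot defect.\<close>

lemma shock_wave_weak_form:
  fixes \<sigma> a b f g :: real and \<phi> :: "real \<times> real \<Rightarrow> real"
  assumes "C1_compact_support \<phi>" and "\<sigma> < 0"
  defines "F \<equiv> \<lambda>z. shock_wave \<sigma> a b z * partial_t \<phi> z + shock_wave \<sigma> f g z * partial_x \<phi> z"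
  shows set_integrable_shock_wave_weak_form: "set_integrable lebesgue piston_domain F"
    and LINT_shock_wave_weak_form: "(LINT z:piston_domain|lebesgue. F z) =
      (f - g - \<sigma> * (a - b)) * (LINT t:{0<..}|lborel. \<phi> (t, \<sigma> * t))
      + g * (LINT t:{0<..}|lborel. \<phi> (t, 0)) - a * (LINT x:{..<0}|lborel. \<phi> (0, x))"
proof -
  obtain R where \<phi>: "continuous_on UNIV (partial_t \<phi>)" "continuous_on UNIV (partial_x \<phi>)"
    "\<And>z. R < norm z \<Longrightarrow> partial_t \<phi> z = 0" "\<And>z. R < norm z \<Longrightarrow> partial_x \<phi> z = 0"
    using assms(1) by (rule C1_compact_supportE) blast
  have [measurable]: "partial_t \<phi> \<in> borel_measurable borel" "partial_x \<phi> \<in> borel_measurable borel"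
    by (intro borel_measurable_continuous_onI \<phi>)+
  have int: "set_integrable lborel piston_domain (\<lambda>z. shock_wave \<sigma> a b z * partial_t \<phi> z)"
    "set_integrable lborel piston_domain (\<lambda>z. shock_wave \<sigma> f g z * partial_x \<phi> z)"
    unfolding set_integrable_def real_scaleR_def
    by (intro integrable_indicator_mult integrable_lborel_shock_wave_mult
        integrable_lborel_bounded_support \<phi>; simp)+
  have meas: "F \<in> borel_measurable borel"
    unfolding F_def by measurable
  show "set_integrable lebesgue piston_domain F"
    unfolding set_integrable_lebesgue_iff_lborel[OF piston_domain_borel meas]
    unfolding F_def by (intro set_integral_add int)
  show "(LINT z:piston_domain|lebesgue. F z) =
      (f - g - \<sigma> * (a - b)) * (LINT t:{0<..}|lborel. \<phi> (t, \<sigma> * t))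
      + g * (LINT t:{0<..}|lborel. \<phi> (t, 0)) - a * (LINT x:{..<0}|lborel. \<phi> (0, x))"
    unfolding LINT_lebesgue_eq_lborel[OF piston_domain_borel meas]
    unfolding F_def set_integral_add(2)[OF int]
      LINT_shock_wave_partial_t[OF assms(1,2)] LINT_shock_wave_partial_x[OF assms(1,2)]
    by (simp add: algebra_simps)
qed

section \<open>A test function that detects the shock line\<close>

lemma has_real_derivative_square_pos_part:
  "((\<lambda>s::real. (max 0 s)\<^sup>2) has_real_derivative 2 * max 0 s) (at s)"
proof -
  consider "s > 0" | "s < 0" | "s = 0" by linarith
  then show ?thesis
  proof cases
    case 1
    have "((\<lambda>s. s\<^sup>2) has_real_derivative 2 * max 0 s) (at s)"
      using 1 by (auto intro!: derivative_eq_intros)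
    then show ?thesis
      by (rule has_field_derivative_transform_within_open[of _ _ _ "{0<..}"]) (use 1 in auto)
  next
    case 2
    have "((\<lambda>s. 0) has_real_derivative 2 * max 0 s) (at s)"
      using 2 by (auto intro!: derivative_eq_intros)
    then show ?thesis
      by (rule has_field_derivative_transform_within_open[of _ _ _ "{..<0}"]) (use 2 in auto)
  next
    case 3
    have "((\<lambda>h::real. max 0 h) \<longlongrightarrow> 0) (at 0)"
      by (auto intro!: tendsto_eq_intros)
    \<comment> \<open>Away from \<open>h = 0\<close> the difference quotient of the square is
      \<open>max 0 h\<close> itself.\<close>
    then have "((\<lambda>h::real. (max 0 h)\<^sup>2 / h) \<longlongrightarrow> 0) (at 0)"
      by (rule Lim_transform_eventually)
        (auto simp: eventually_at_filter max_def power2_eq_square)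
    then show ?thesis using 3 by (simp add: DERIV_def)
  qed
qed

text \<open>Squaring the positive part smooths its corner enough for a continuous gradient. The
  factor \<open>- 4\<close> in that gradient is 2 from the square times \<open>- 2\<close> from the
  inner product.\<close>

lemma C1_compact_support_bump:
  fixes w :: "real \<times> real"
  shows "C1_compact_support (\<lambda>z. (max 0 (1 - (z - w) \<bullet> (z - w)))\<^sup>2)" (is "C1_compact_support ?b")
  unfolding C1_compact_support_def
proof (intro conjI exI allI)
  define \<phi>' where "\<phi>' z = (- 4 * max 0 (1 - (z - w) \<bullet> (z - w))) *\<^sub>R blinfun_inner_right (z - w)" for z
  show "continuous_on UNIV \<phi>'"
    unfolding \<phi>'_def by (intro continuous_intros bounded_linear.continuous_on[OF bounded_linear_blinfun_inner_right])
  show "(?b has_derivative blinfun_apply (\<phi>' z)) (at z)" for z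
  proof -
    have "((\<lambda>z. 1 - (z - w) \<bullet> (z - w)) has_derivative (\<lambda>h. - 2 * ((z - w) \<bullet> h))) (at z)"
      by (auto intro!: derivative_eq_intros simp: inner_commute)
    from has_derivative_compose[OF this
        has_real_derivative_square_pos_part[THEN has_field_derivative_imp_has_derivative]]
    have "(?b has_derivative (\<lambda>h. 2 * max 0 (1 - (z - w) \<bullet> (z - w)) * (- 2 * ((z - w) \<bullet> h)))) (at z)" .
    moreover have "blinfun_apply (\<phi>' z) = (\<lambda>h. 2 * max 0 (1 - (z - w) \<bullet> (z - w)) * (- 2 * ((z - w) \<bullet> h)))"
      by (simp add: \<phi>'_def blinfun.scaleR_left blinfun.minus_left fun_eq_iff)
    ultimately show ?thesis by simp
  qed
  have "{z. ?b z \<noteq> 0} \<subseteq> ball w 1"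
  proof
    fix z assume "z \<in> {z. ?b z \<noteq> 0}"
    then have "(norm (z - w))\<^sup>2 < 1"
      unfolding power2_norm_eq_inner by (auto simp: max_def split: if_splits)
    then show "z \<in> ball w 1"
      by (simp add: power_less_one_iff abs_square_less_1 dist_norm norm_minus_commute)
  qed
  then show "compact (closure {z. ?b z \<noteq> 0})"
    using bounded_subset[OF bounded_ball] compact_closure by blast
qed

text \<open>A nonnegative bump centred at \<open>(1, \<sigma>)\<close>, the point of the shock line
  at time 1, works. Such a test function makes the Rankine-Hugoniot conditions necessary.\<close>

lemma C1_compact_support_line_integral_nonzero:
  obtains \<phi> where "C1_compact_support \<phi>" and "(LINT t:{0<..}|lborel. \<phi> (t, \<sigma> * t)) \<noteq> 0"
proof -
  define \<phi> :: "real \<times> real \<Rightarrow> real"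
    where "\<phi> z = (max 0 (1 - (z - (1, \<sigma>)) \<bullet> (z - (1, \<sigma>))))\<^sup>2" for z
  have C1: "C1_compact_support \<phi>"
    unfolding \<phi>_def by (rule C1_compact_support_bump)
  then obtain R where cont: "continuous_on UNIV \<phi>" and R: "\<And>z. R < norm z \<Longrightarrow> \<phi> z = 0"
    by (rule C1_compact_supportE) blast
  let ?f = "\<lambda>t. indicator {0<..} t * \<phi> (t, \<sigma> * t)"
  have int: "integrable lborel ?f"
    by (intro integrable_indicator_mult integrable_lborel_slice_line[OF cont R]) auto
  have "(LINT t|lborel. ?f t) \<noteq> 0"
  proof
    assume "(LINT t|lborel. ?f t) = 0"
    then have ae: "AE t in lborel. ?f t = 0"
      using int by (subst (asm) integral_nonneg_eq_0_iff_AE) (auto simp: \<phi>_def)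
    \<comment> \<open>If the integral were 0, the integrand would vanish almost everywhere; but it
      is nonzero on this open set, which contains 1 and hence an interval of positive
      length.\<close>
    define S where "S = {t. 0 < t \<and> \<phi> (t, \<sigma> * t) \<noteq> 0}"
    have "open S"
      unfolding S_def
      by (intro open_Collect_conj open_Collect_less open_Collect_neq
          continuous_on_compose2[OF cont] continuous_intros) auto
    have "1 \<in> S"
      by (simp add: S_def \<phi>_def zero_prod_def[symmetric])
    have "S \<in> null_sets lebesgue"
    proof -
      have "S \<in> sets lborel" using \<open>open S\<close> by simp
      moreover have "AE t in lborel. t \<notin> S"
        using ae by eventually_elim (auto simp: S_def)
      ultimately have "S \<in> null_sets lborel"
        by (simp add: AE_iff_null_sets)
      then show ?thesis by (rule null_sets_completionI)
    qed
    moreover obtain e where "e > 0" "ball 1 e \<subseteq> S"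
      using \<open>open S\<close> \<open>1 \<in> S\<close> by (rule openE)
    moreover have "box (1 - e) (1 + e) = ball 1 e"
      by (simp add: box_real ball_eq_greaterThanLessThan)
    ultimately have "negligible (box (1 - e) (1 + e))"
      using negligible_iff_null_sets negligible_subset by metis
    then show False
      using \<open>e > 0\<close> unfolding negligible_interval by simp
  qed
  with C1 show ?thesis
    by (intro that[of \<phi>]) (simp_all add: set_lebesgue_integral_def)
qed

section \<open>Equivalence with the Rankine-Hugoniot conditions\<close>

lemma shock_wave_tendsto_at_left_0:
  assumes "\<sigma> < 0" and "t > 0"
  shows "((\<lambda>x. P (shock_wave \<sigma> a b (t, x))) \<longlongrightarrow> P b) (at_left 0)"
proof (rule tendsto_eventually)
  have "P (shock_wave \<sigma> a b (t, x)) = P b" if "\<sigma> * t < x" for x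
    using that assms(2) by (simp add: shock_wave_def pos_divide_less_eq)
  then show "eventually (\<lambda>x. P (shock_wave \<sigma> a b (t, x)) = P b) (at_left 0)"
    unfolding eventually_at_left_field using mult_neg_pos[OF assms] by blast
qed

text \<open>The state at the piston is at rest, so its mass flux is 0 and its momentum flux is the
  pressure, which cancels the boundary term. Each balance thus becomes its Rankine-Hugoniot defect
  times the integral along the shock: zero defects suffice, and one test function with nonzero
  integral forces them.\<close>

lemma piston_integral_solution_shock_wave_iff:
  fixes \<rho>\<^sub>l \<rho>\<^sub>r u \<sigma> :: real
  assumes \<sigma>: "\<sigma> < 0"
  shows "piston_integral_solution P (\<lambda>x. \<rho>\<^sub>l) (\<lambda>x. u) (shock_wave \<sigma> \<rho>\<^sub>l \<rho>\<^sub>r) (shock_wave \<sigma> u 0) \<longleftrightarrow>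
    \<rho>\<^sub>l * u = \<sigma> * (\<rho>\<^sub>l - \<rho>\<^sub>r) \<and> \<rho>\<^sub>l * u\<^sup>2 + P \<rho>\<^sub>l - P \<rho>\<^sub>r = \<sigma> * (\<rho>\<^sub>l * u)"
    (is "?sol \<longleftrightarrow> ?mass \<and> ?mom")
proof -
  let ?\<rho> = "shock_wave \<sigma> \<rho>\<^sub>l \<rho>\<^sub>r" and ?u = "shock_wave \<sigma> u 0"
  let ?I = "\<lambda>\<phi>. LINT t:{0<..}|lborel. \<phi> (t, \<sigma> * t)"
  \<comment> \<open>All factors jump across the same line, so the fluxes are again two-state waves
    and the linear weak form applies.\<close>
  have flux: "?\<rho> z * ?u z = shock_wave \<sigma> (\<rho>\<^sub>l * u) 0 z"
    "?\<rho> z * (?u z)\<^sup>2 + P (?\<rho> z) = shock_wave \<sigma> (\<rho>\<^sub>l * u\<^sup>2 + P \<rho>\<^sub>l) (P \<rho>\<^sub>r) z" for z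
    by (auto simp: shock_wave_def case_prod_unfold power2_eq_square)
  note weak = set_integrable_shock_wave_weak_form[OF _ \<sigma>] LINT_shock_wave_weak_form[OF _ \<sigma>]
  have traces: "set_integrable lebesgue {..<0} (\<lambda>x. c * \<phi> (0, x))"
    "set_integrable lebesgue {0<..} (\<lambda>t. c * \<phi> (t, 0))"
    "(LINT x:{..<0}|lebesgue. c * \<phi> (0, x)) = c * (LINT x:{..<0}|lborel. \<phi> (0, x))"
    "(LINT t:{0<..}|lebesgue. c * \<phi> (t, 0)) = c * (LINT t:{0<..}|lborel. \<phi> (t, 0))"
    if C1: "C1_compact_support \<phi>" for \<phi> c
  proof -
    obtain R where \<phi>: "continuous_on UNIV \<phi>" "\<And>z. R < norm z \<Longrightarrow> \<phi> z = 0"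
      using C1 by (rule C1_compact_supportE) blast
    have int: "integrable lborel (\<lambda>x. c * \<phi> (0, x))" "integrable lborel (\<lambda>t. c * \<phi> (t, 0))"
      using integrable_lborel_slice_snd[OF \<phi>, where R = R and t = 0]
        integrable_lborel_slice_line[OF \<phi>, where R = R and c = 0] by simp_all
    have meas: "(\<lambda>x. c * \<phi> (0, x)) \<in> borel_measurable borel"
      "(\<lambda>t. c * \<phi> (t, 0)) \<in> borel_measurable borel"
      using int[THEN borel_measurable_integrable] by simp_all
    have "set_integrable lborel {..<0} (\<lambda>x. c * \<phi> (0, x))"
      "set_integrable lborel {0<..} (\<lambda>t. c * \<phi> (t, 0))"
      unfolding set_integrable_def real_scaleR_def
      by (rule integrable_indicator_mult[OF _ int(1)] integrable_indicator_mult[OF _ int(2)]; simp)+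
    then show "set_integrable lebesgue {..<0} (\<lambda>x. c * \<phi> (0, x))"
      "set_integrable lebesgue {0<..} (\<lambda>t. c * \<phi> (t, 0))"
      using meas by (simp_all add: set_integrable_lebesgue_iff_lborel)
    show "(LINT x:{..<0}|lebesgue. c * \<phi> (0, x)) = c * (LINT x:{..<0}|lborel. \<phi> (0, x))"
      "(LINT t:{0<..}|lebesgue. c * \<phi> (t, 0)) = c * (LINT t:{0<..}|lborel. \<phi> (t, 0))"
      using LINT_lebesgue_eq_lborel[OF _ meas(1), of "{..<0}"]
        LINT_lebesgue_eq_lborel[OF _ meas(2), of "{0<..}"] by simp_all
  qed
  have mass: "(LINT z:piston_domain|lebesgue. ?\<rho> z * partial_t \<phi> z + ?\<rho> z * ?u z * partial_x \<phi> z)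
      + (LINT x:{..<0}|lebesgue. \<rho>\<^sub>l * \<phi> (0, x)) = (\<rho>\<^sub>l * u - \<sigma> * (\<rho>\<^sub>l - \<rho>\<^sub>r)) * ?I \<phi>"
    if "C1_compact_support \<phi>" for \<phi>
    unfolding flux(1) weak(2)[OF that] traces(3)[OF that] by simp
  have momentum: "(LINT z:piston_domain|lebesgue.
        ?\<rho> z * ?u z * partial_t \<phi> z + (?\<rho> z * (?u z)\<^sup>2 + P (?\<rho> z)) * partial_x \<phi> z)
      - (LINT t:{0<..}|lebesgue. P \<rho>\<^sub>r * \<phi> (t, 0)) + (LINT x:{..<0}|lebesgue. \<rho>\<^sub>l * u * \<phi> (0, x))
      = (\<rho>\<^sub>l * u\<^sup>2 + P \<rho>\<^sub>l - P \<rho>\<^sub>r - \<sigma> * (\<rho>\<^sub>l * u)) * ?I \<phi>"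
    if "C1_compact_support \<phi>" for \<phi>
    unfolding flux weak(2)[OF that] traces(3,4)[OF that] by simp
  show ?thesis
  proof
    assume ?sol
    then obtain p
      where p: "AE t in lebesgue. t > 0 \<longrightarrow> ((\<lambda>x. P (?\<rho> (t, x))) \<longlongrightarrow> p t) (at_left 0)"
        and int: "\<And>\<phi>. C1_compact_support \<phi> \<Longrightarrow> set_integrable lebesgue {0<..} (\<lambda>t. p t * \<phi> (t, 0))"
        and eqs: "\<And>\<phi>. C1_compact_support \<phi> \<Longrightarrow>
          (LINT z:piston_domain|lebesgue. ?\<rho> z * partial_t \<phi> z + ?\<rho> z * ?u z * partial_x \<phi> z)
          + (LINT x:{..<0}|lebesgue. \<rho>\<^sub>l * \<phi> (0, x)) = 0 \<and>
          (LINT z:piston_domain|lebesgue.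
            ?\<rho> z * ?u z * partial_t \<phi> z + (?\<rho> z * (?u z)\<^sup>2 + P (?\<rho> z)) * partial_x \<phi> z)
          - (LINT t:{0<..}|lebesgue. p t * \<phi> (t, 0))
          + (LINT x:{..<0}|lebesgue. \<rho>\<^sub>l * u * \<phi> (0, x)) = 0"
      unfolding piston_integral_solution_def by blast
    obtain \<phi> where \<phi>: "C1_compact_support \<phi>" "?I \<phi> \<noteq> 0"
      using C1_compact_support_line_integral_nonzero by blast
    \<comment> \<open>The boundary pressure \<open>p\<close> is only given to exist; uniqueness of
      limits identifies it almost everywhere before the balances can be compared.\<close>
    from p have "AE t in lebesgue. t > 0 \<longrightarrow> p t = P \<rho>\<^sub>r"
      by eventually_elim
        (use shock_wave_tendsto_at_left_0[OF \<sigma>] tendsto_unique trivial_limit_at_left_real in blast)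
    then have "(LINT t:{0<..}|lebesgue. p t * \<phi> (t, 0)) = (LINT t:{0<..}|lebesgue. P \<rho>\<^sub>r * \<phi> (t, 0))"
      unfolding set_lebesgue_integral_def
      using int[OF \<phi>(1)] traces(2)[OF \<phi>(1), of "P \<rho>\<^sub>r"]
      by (intro integral_cong_AE) (auto simp: set_integrable_def indicator_def elim: AE_mp)
    then show "?mass \<and> ?mom"
      using eqs[OF \<phi>(1)] mass[OF \<phi>(1)] momentum[OF \<phi>(1)] \<phi>(2) by simp
  next
    assume RH: "?mass \<and> ?mom"
    show ?sol
      unfolding piston_integral_solution_def
    proof (intro conjI exI[of _ "\<lambda>t. P \<rho>\<^sub>r"] allI impI)
      show "Linf_on ({0..} \<times> {..0}) ?\<rho>" "Linf_on ({0..} \<times> {..0}) ?u"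
        by (intro Linf_on_shock_wave borel_closed closed_Times closed_atLeast closed_atMost)+
      show "AE t in lebesgue. t > 0 \<longrightarrow> ((\<lambda>x. P (?\<rho> (t, x))) \<longlongrightarrow> P \<rho>\<^sub>r) (at_left 0)"
        by (intro AE_I2 impI shock_wave_tendsto_at_left_0 \<sigma>)
    next
      fix \<phi> assume \<phi>: "C1_compact_support \<phi>"
      show "set_integrable lebesgue piston_domain
          (\<lambda>z. ?\<rho> z * partial_t \<phi> z + ?\<rho> z * ?u z * partial_x \<phi> z)"
        "set_integrable lebesgue piston_domain
          (\<lambda>z. ?\<rho> z * ?u z * partial_t \<phi> z + (?\<rho> z * (?u z)\<^sup>2 + P (?\<rho> z)) * partial_x \<phi> z)"
        unfolding flux by (intro weak(1) \<phi>)+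
    qed (use traces mass momentum RH in simp_all)
  qed
qed

section \<open>Solving the Rankine-Hugoniot conditions for the Chaplygin pressure\<close>

lemma chaplygin_pressure_diff_ge:
  assumes "0 < \<alpha>" and "B > 0" and "0 < r" and "r \<le> s"
  shows "A * (s - r) \<le> chaplygin_pressure A B \<alpha> s - chaplygin_pressure A B \<alpha> r"
proof -
  have "B / s powr \<alpha> \<le> B / r powr \<alpha>"
    using assms by (intro divide_left_mono powr_mono2 mult_pos_pos) auto
  then show ?thesis by (simp add: chaplygin_pressure_def algebra_simps)
qed

text \<open>Clearing the denominator \<open>r - 1\<close> gives a function continuous up to
  \<open>r = 1\<close>, where it equals \<open>- 2\<close>, so the intermediate value theorem yields
  a root. Uniqueness sets the growth of the pressure against the decrease of
  \<open>2 * r / (r - 1)\<close>.\<close>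

lemma ex1_chaplygin_shock_density:
  assumes "0 < \<alpha>" and "A > 0" and "B > 0"
  shows "\<exists>!r. r > 1 \<and>
    (r - 1) * (chaplygin_pressure A B \<alpha> r - chaplygin_pressure A B \<alpha> 1) = 2 * r"
proof -
  let ?P = "chaplygin_pressure A B \<alpha>"
  define h where "h r = (r - 1) * (?P r - ?P 1) - 2 * r" for r
  \<comment> \<open>As \<open>P\<close> grows at least as fast as \<open>A r\<close>, \<open>h (1 + k) \<ge> 0\<close> as soon as \<open>A k\<^sup>2 \<ge> 2 + 2 k\<close>.\<close>
  define k where "k = 1 + 2 / A"
  have "k > 0" and k: "A * k\<^sup>2 = 2 * k + A * k" "A * k = A + 2"
    using \<open>A > 0\<close> by (auto simp: k_def field_simps power2_eq_square add_pos_pos)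
  have "continuous_on {1..1 + k} h"
    unfolding h_def chaplygin_pressure_def
    by (intro continuous_intros) auto
  moreover have "h 1 \<le> 0" by (simp add: h_def)
  moreover have "0 \<le> h (1 + k)"
  proof -
    have "k * (A * k) \<le> k * (?P (1 + k) - ?P 1)"
      using chaplygin_pressure_diff_ge[of \<alpha> B 1 "1 + k" A] assms \<open>k > 0\<close>
      by (intro mult_left_mono) auto
    then show ?thesis using k \<open>A > 0\<close> by (simp add: h_def power2_eq_square algebra_simps)
  qed
  ultimately obtain r where r: "1 \<le> r" "h r = 0"
    using IVT'[of h 1 0 "1 + k"] \<open>k > 0\<close> by auto
  then have "r > 1" by (cases "r = 1") (auto simp: h_def)
  have "\<not> (r < s \<and> h r = 0 \<and> h s = 0)" if "1 < r" for r s
  proof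
    assume rs: "r < s \<and> h r = 0 \<and> h s = 0"
    have "?P r < ?P s"
      using chaplygin_pressure_diff_ge[of \<alpha> B r s A] assms rs that
      by (smt (verit) mult_pos_pos)
    \<comment> \<open>Substituting the equations for \<open>r\<close> and \<open>s\<close> reduces
      this to \<open>(s - 1) * (2 * r) < (r - 1) * (2 * s)\<close>, that is
      \<open>s < r\<close>.\<close>
    then have "(r - 1) * (s - 1) * (?P r - ?P 1) < (r - 1) * (s - 1) * (?P s - ?P 1)"
      using rs that by (intro mult_strict_left_mono) auto
    moreover have "(r - 1) * (s - 1) * (?P r - ?P 1) = (s - 1) * (2 * r)"
      "(r - 1) * (s - 1) * (?P s - ?P 1) = (r - 1) * (2 * s)"
      using rs by (auto simp: h_def mult.assoc mult.left_commute)
    ultimately show False using rs by (simp add: algebra_simps)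
  qed
  then have uniq: "s = r" if "s > 1" "h s = 0" for s
    using that r \<open>r > 1\<close> by (metis linorder_neqE_linordered_idom)
  have "(s - 1) * (?P s - ?P 1) = 2 * s \<longleftrightarrow> h s = 0" for s
    by (simp add: h_def)
  then show ?thesis
    using r \<open>r > 1\<close> uniq by blast
qed

theorem theorem4p1:
  fixes \<alpha> A B M\<^sub>0 :: real
  assumes "0 < \<alpha>" and "\<alpha> < 1" and "A > 0" and "B > 0" and "M\<^sub>0 > 0"
    and "A + B * \<alpha> = 2 / M\<^sub>0\<^sup>2"
  shows "\<exists>!(\<rho>\<^sub>1, \<sigma>). \<rho>\<^sub>1 > 0 \<and> \<sigma> < 0 \<and>
           piston_integral_solution (chaplygin_pressure A B \<alpha>) (\<lambda>x. 1) (\<lambda>x. sqrt 2)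
             (shock_wave \<sigma> 1 \<rho>\<^sub>1) (shock_wave \<sigma> (sqrt 2) 0)"
proof -
  let ?P = "chaplygin_pressure A B \<alpha>"
  have RH: "\<rho>\<^sub>1 > 0 \<and> \<sigma> < 0 \<and> piston_integral_solution ?P (\<lambda>x. 1) (\<lambda>x. sqrt 2)
        (shock_wave \<sigma> 1 \<rho>\<^sub>1) (shock_wave \<sigma> (sqrt 2) 0) \<longleftrightarrow>
      \<sigma> = sqrt 2 / (1 - \<rho>\<^sub>1) \<and> \<rho>\<^sub>1 > 1 \<and> (\<rho>\<^sub>1 - 1) * (?P \<rho>\<^sub>1 - ?P 1) = 2 * \<rho>\<^sub>1"
    (is "_ \<longleftrightarrow> ?rhs") for \<rho>\<^sub>1 \<sigma>
  proof -
    \<comment> \<open>As \<open>sqrt 2 > 0\<close>, a negative speed amounts to compression, and the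
      density then determines the speed. Uniqueness of the pair is thereby reduced to uniqueness of
      the density.\<close>
    have mass: "\<sigma> < 0 \<and> sqrt 2 = \<sigma> * (1 - \<rho>\<^sub>1) \<longleftrightarrow> \<rho>\<^sub>1 > 1 \<and> \<sigma> = sqrt 2 / (1 - \<rho>\<^sub>1)"
    proof
      assume *: "\<sigma> < 0 \<and> sqrt 2 = \<sigma> * (1 - \<rho>\<^sub>1)"
      then have "\<sigma> * (1 - \<rho>\<^sub>1) > 0" by (metis real_sqrt_gt_0_iff zero_less_numeral)
      then have "\<rho>\<^sub>1 > 1" using * by (simp add: zero_less_mult_iff)
      with * show "\<rho>\<^sub>1 > 1 \<and> \<sigma> = sqrt 2 / (1 - \<rho>\<^sub>1)" by (simp add: field_simps)
    qed (simp add: divide_pos_neg)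
    have momentum: "2 + ?P 1 - ?P \<rho>\<^sub>1 = \<sigma> * sqrt 2 \<longleftrightarrow> (\<rho>\<^sub>1 - 1) * (?P \<rho>\<^sub>1 - ?P 1) = 2 * \<rho>\<^sub>1"
      if "\<rho>\<^sub>1 > 1" "\<sigma> = sqrt 2 / (1 - \<rho>\<^sub>1)"
    proof -
      \<comment> \<open>This eliminates the speed from the momentum condition, leaving an equation
        in the density alone.\<close>
      have eq: "\<sigma> * sqrt 2 = 2 / (1 - \<rho>\<^sub>1)" by (simp add: that)
      have "2 + ?P 1 - ?P \<rho>\<^sub>1 = \<sigma> * sqrt 2 \<longleftrightarrow> (2 + ?P 1 - ?P \<rho>\<^sub>1) * (1 - \<rho>\<^sub>1) = 2"
        unfolding eq using \<open>\<rho>\<^sub>1 > 1\<close> by (simp add: eq_divide_eq)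
      then show ?thesis by (auto simp: algebra_simps)
    qed
    show ?thesis
      using mass momentum piston_integral_solution_shock_wave_iff[of \<sigma> ?P 1 "sqrt 2" \<rho>\<^sub>1]
      by fastforce
  qed
  obtain r where r: "r > 1 \<and> (r - 1) * (?P r - ?P 1) = 2 * r"
    and uniq: "\<And>s. s > 1 \<and> (s - 1) * (?P s - ?P 1) = 2 * s \<Longrightarrow> s = r"
    using ex1_chaplygin_shock_density[OF assms(1,3,4)] by (metis (no_types))
  show ?thesis
    unfolding RH
  proof (rule ex1I[of _ "(r, sqrt 2 / (1 - r))"])
    show "z = (r, sqrt 2 / (1 - r))"
      if "case z of (\<rho>\<^sub>1, \<sigma>) \<Rightarrow>
        \<sigma> = sqrt 2 / (1 - \<rho>\<^sub>1) \<and> \<rho>\<^sub>1 > 1 \<and> (\<rho>\<^sub>1 - 1) * (?P \<rho>\<^sub>1 - ?P 1) = 2 * \<rho>\<^sub>1" for z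
      using that uniq[of "fst z"] by (cases z) simp
  qed (use r in simp)
qed

end
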